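(* Let $E$ be a normed space, let $F$ be a quasi-complete Hausdorff locally convex space (over the same field $\mathbb{K}=\mathbb{R}$ or $\mathbb{C}$), and let $\mathfrak{P}$ be a cone property of bounded subsets of $E$. Then the set $$\{T\in\mathcal{L}(E,F) : T(C)\text{ is relatively compact in }F\text{ for every bounded set } C\subseteq E\text{ having }\mathfrak{P}\}$$ is a closed linear subspace of $\mathcal{L}(E,F)$ in the topology of uniform convergence on bounded sets.
   Context: $\mathcal{L}(E,F)$ is the space of continuous linear operators from $E$ to $F$. A property $\mathfrak{P}$ of bounded subsets of $E$ is a cone property if $\lambda C$ has $\mathfrak{P}$ whenever $\lambda>0$ and $C$ has $\mathfrak{P}$. A topological vector space is quasi-complete if each of its bounded closed subsets is complete with respect to the induced uniform structure. A subset is relatively compact if its closure is compact. If the topology of $F$ is generated by the family of seminorms $\{p_i: i\in I\}$, the topology of uniform convergence on bounded sets on $\mathcal{L}(E,F)$ is the one generated by the seminorms $P_i(T)=\sup\{p_i(T(x)) : x\in E,\ \|x\|\le 1\}$, $i\in I$. *)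

theory Defs
  imports "HOL-Analysis.Analysis" "HOL-Library.Function_Algebras"
begin

text \<open>
  The scalar field is a type \<open>'k\<close> of class \<^class>\<open>real_normed_field\<close>, whose norm is multiplicative.
  By the Gelfand-Mazur theorem such a field is, up to isometric isomorphism, the real or the
  complex numbers, so the results cover exactly these two fields. Vector spaces over \<open>'k\<close> are given by
  an explicit scalar multiplication as in \<^locale>\<open>vector_space\<close>.
\<close>

text \<open>
  The class \<^class>\<open>real_normed_vector\<close> supplies the norm and its topology. Its own \<open>(*\<^sub>R)\<close> is not
  used; it necessarily agrees with \<open>\<lambda>r. scl (of_real r)\<close>, both being additive and continuous in \<open>r\<close>.
\<close>

locale normed_vector_space = vector_space scl
  for scl :: "'k::real_normed_field \<Rightarrow> 'v::real_normed_vector \<Rightarrow> 'v" +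
  assumes norm_scale: "norm (scl c x) = norm c * norm x"

text \<open>
  Class \<^class>\<open>uniform_topological_group_add\<close> makes addition and negation uniformly continuous. For a
  commutative group this forces the uniformity to be the canonical translation-invariant one of
  the group topology, so \<^const>\<open>complete\<close> below is completeness in the usual uniform structure.
\<close>

locale topological_vector_space = vector_space scl
  for scl :: "'k::real_normed_field \<Rightarrow> 'v::{uniform_topological_group_add, ab_group_add} \<Rightarrow> 'v" +
  assumes continuous_scale: "continuous_on UNIV (\<lambda>(c, x). scl c x)"

definition tvs_bounded ::
    "('k::real_normed_field \<Rightarrow> 'v::{topological_space, zero} \<Rightarrow> 'v) \<Rightarrow> 'v set \<Rightarrow> bool"
  where "tvs_bounded scl B \<longleftrightarrow>
    (\<forall>U. open U \<longrightarrow> 0 \<in> U \<longrightarrow> (\<exists>s>0. \<forall>c. norm c \<ge> s \<longrightarrow> B \<subseteq> scl c ` U))"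

definition quasi_complete ::
    "('k::real_normed_field \<Rightarrow> 'v::{uniform_space, zero} \<Rightarrow> 'v) \<Rightarrow> bool"
  where "quasi_complete scl \<longleftrightarrow> (\<forall>B. closed B \<longrightarrow> tvs_bounded scl B \<longrightarrow> complete B)"

definition relatively_compact :: "'v::topological_space set \<Rightarrow> bool"
  where "relatively_compact S \<longleftrightarrow> compact (closure S)"

definition seminorm ::
    "('k::real_normed_field \<Rightarrow> 'v::ab_group_add \<Rightarrow> 'v) \<Rightarrow> ('v \<Rightarrow> real) \<Rightarrow> bool"
  where "seminorm scl q \<longleftrightarrow>
    (\<forall>x. q x \<ge> 0) \<and> (\<forall>x y. q (x + y) \<le> q x + q y) \<and> (\<forall>c x. q (scl c x) = norm c * q x)"

text \<open>
  The topology on the carrier \<open>V\<close> with the open \<open>p i\<close>-balls, \<open>i \<in> I\<close>, as subbasis; \<open>V\<close> itself is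
  inserted so that it is the whole space even if \<open>I\<close> is empty.
\<close>

definition seminorm_topology ::
    "'v::ab_group_add set \<Rightarrow> 'i set \<Rightarrow> ('i \<Rightarrow> 'v \<Rightarrow> real) \<Rightarrow> 'v topology"
  where "seminorm_topology V I p =
    topology_generated_by (insert V {{y \<in> V. p i (y - x) < r} | i x r. i \<in> I \<and> x \<in> V \<and> r > 0})"

lemma topspace_seminorm_topology [simp]: "topspace (seminorm_topology V I p) = V"
  unfolding seminorm_topology_def topology_generated_by_topspace by auto

locale locally_convex_space = topological_vector_space scl
  for scl :: "'k::real_normed_field \<Rightarrow> 'v::{uniform_topological_group_add, ab_group_add} \<Rightarrow> 'v" +
  fixes I :: "'i set" and p :: "'i \<Rightarrow> 'v \<Rightarrow> real"
  assumes seminorms: "i \<in> I \<Longrightarrow> seminorm scl (p i)"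
    and generated: "euclidean = seminorm_topology UNIV I p"

definition cone_property ::
    "('k::real_normed_field \<Rightarrow> 'v::real_normed_vector \<Rightarrow> 'v) \<Rightarrow> ('v set \<Rightarrow> bool) \<Rightarrow> bool"
  where "cone_property scl P \<longleftrightarrow>
    (\<forall>C (t::real). bounded C \<longrightarrow> P C \<longrightarrow> t > 0 \<longrightarrow> P (scl (of_real t) ` C))"

definition continuous_linear_operators ::
    "('k::field \<Rightarrow> 'e::{topological_space, ab_group_add} \<Rightarrow> 'e) \<Rightarrow>
     ('k \<Rightarrow> 'f::{topological_space, ab_group_add} \<Rightarrow> 'f) \<Rightarrow> ('e \<Rightarrow> 'f) set"
  where "continuous_linear_operators scaleE scaleF =
    {T. Vector_Spaces.linear scaleE scaleF T \<and> continuous_on UNIV T}"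

definition operator_seminorm ::
    "('f \<Rightarrow> real) \<Rightarrow> ('e::real_normed_vector \<Rightarrow> 'f) \<Rightarrow> real"
  where "operator_seminorm q T = (SUP x\<in>{x. norm x \<le> 1}. q (T x))"

text \<open>
  \<open>p\<close> is a family of seminorms generating the topology of the codomain; the result does not depend
  on its choice.
\<close>

definition bounded_convergence_topology ::
    "('k::field \<Rightarrow> 'e::real_normed_vector \<Rightarrow> 'e) \<Rightarrow>
     ('k \<Rightarrow> 'f::{topological_space, ab_group_add} \<Rightarrow> 'f) \<Rightarrow>
     'i set \<Rightarrow> ('i \<Rightarrow> 'f \<Rightarrow> real) \<Rightarrow> ('e \<Rightarrow> 'f) topology"
  where "bounded_convergence_topology scaleE scaleF I p =
    seminorm_topology (continuous_linear_operators scaleE scaleF) I (\<lambda>i. operator_seminorm (p i))"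

definition operators_compact_on ::
    "('k::field \<Rightarrow> 'e::real_normed_vector \<Rightarrow> 'e) \<Rightarrow>
     ('k \<Rightarrow> 'f::{topological_space, ab_group_add} \<Rightarrow> 'f) \<Rightarrow> ('e set \<Rightarrow> bool) \<Rightarrow> ('e \<Rightarrow> 'f) set"
  where "operators_compact_on scaleE scaleF P =
    {T \<in> continuous_linear_operators scaleE scaleF.
      \<forall>C. bounded C \<longrightarrow> P C \<longrightarrow> relatively_compact (T ` C)}"

definition pointwise_scale :: "('k \<Rightarrow> 'f \<Rightarrow> 'f) \<Rightarrow> 'k \<Rightarrow> ('e \<Rightarrow> 'f) \<Rightarrow> 'e \<Rightarrow> 'f"
  where "pointwise_scale scl c T = (\<lambda>x. scl c (T x))"

end

theory Submission
  imports Defs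
begin

text \<open>
  Algebraic closure is formal: \<open>(S + T) ` C\<close> lies in the sum of two compact sets, and
  \<open>(c T) ` C\<close> in a scalar multiple of a compact set.

  For topological closedness, let \<open>T\<close> be in the closure and let \<open>C\<close> be a bounded set with the
  property. Neighbourhoods of \<open>T\<close> control operators only on the unit ball, and this is where the
  cone property enters: a small positive multiple of \<open>C\<close> lies in the unit ball and still has the
  property, and \<open>T ` C\<close> is a multiple of the image of that set, so \<open>C\<close> may be assumed to lie in
  the unit ball. Given finitely many of the seminorms and \<open>e > 0\<close>, choose an operator \<open>S\<close> in the
  set that is uniformly \<open>e/2\<close>-close to \<open>T\<close> on \<open>C\<close>. Since \<open>S ` C\<close> is relatively compact, it has a
  finite \<open>e/2\<close>-net, which is a finite \<open>e\<close>-net for \<open>T ` C\<close>. Hence \<open>T ` C\<close> is totally bounded. Its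
  closure is closed and bounded, so complete by quasi-completeness, and a complete totally bounded
  set is compact.

  The last implication is proved for arbitrary uniform spaces, with ultrafilters
  (\<open>complete_totally_bounded_imp_compact\<close>). The link between uniform structure and seminorms is
  \<open>eventually_uniformity_seminorms\<close>: the canonical uniformity is generated by the relations
  \<open>p i (y - x) < e\<close>, where \<open>i\<close> ranges over finitely many indices.
\<close>

section \<open>Total boundedness and compactness in uniform spaces\<close>

text \<open>
  Zorn's lemma yields a minimal proper filter below \<open>F\<close>. If it does not contain the complement of
  \<open>Q\<close>, then adjoining \<open>Q\<close> to it gives a proper filter, so by minimality \<open>Q\<close> was already in it.
\<close>

lemma ultrafilter_below:
  fixes F :: "'a filter"
  assumes "F \<noteq> bot"
  obtains G where "G \<le> F" "G \<noteq> bot"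
    "\<And>Q. eventually Q G \<or> eventually (\<lambda>x. \<not> Q x) G"
proof -
  let ?A = "{G. G \<le> F \<and> G \<noteq> bot}"
  let ?R = "relation_of (\<lambda>G H. H \<le> G) ?A"
  have "\<exists>G\<in>?A. \<forall>H\<in>?A. H \<le> G \<longrightarrow> H = G"
  proof (rule predicate_Zorn)
    show "partial_order_on ?A ?R"
      by (rule partial_order_on_relation_ofI) auto
    fix C assume C: "C \<in> Chains ?R"
    show "\<exists>U\<in>?A. \<forall>G\<in>C. U \<le> G"
    proof (cases "C = {}")
      case True
      with assms show ?thesis by auto
    next
      case False
      have mem: "G \<le> F" "G \<noteq> bot" if "G \<in> C" for G
        using C that by (auto simp: Chains_def relation_of_def)
      have total: "G \<le> H \<or> H \<le> G" if "G \<in> C" "H \<in> C" for G H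
        using C that by (auto simp: Chains_def relation_of_def)
      have "eventually Q (Inf C) \<longleftrightarrow> (\<exists>G\<in>C. eventually Q G)" for Q
        by (rule eventually_Inf_base[OF False]) (metis inf.absorb1 inf.absorb2 order_refl total)
      then have "Inf C \<noteq> bot"
        using mem(2) by (metis trivial_limit_def)
      moreover have "Inf C \<le> F"
        using False mem(1) by (meson Inf_lower2 ex_in_conv)
      ultimately show ?thesis
        by (auto intro: Inf_lower)
    qed
  qed
  then obtain G where G: "G \<le> F" "G \<noteq> bot"
    and min: "\<And>H. H \<le> F \<Longrightarrow> H \<noteq> bot \<Longrightarrow> H \<le> G \<Longrightarrow> H = G"
    by blast
  have "eventually Q G \<or> eventually (\<lambda>x. \<not> Q x) G" for Q
  proof (rule disjCI)
    assume "\<not> eventually (\<lambda>x. \<not> Q x) G"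
    then have "inf G (principal {x. Q x}) \<noteq> bot"
      by (simp add: trivial_limit_def eventually_inf_principal)
    then have "inf G (principal {x. Q x}) = G"
      using G(1) by (intro min) (auto intro: le_infI1)
    then have "eventually Q (inf G (principal {x. Q x})) = eventually Q G"
      by simp
    then show "eventually Q G"
      by (simp add: eventually_inf_principal)
  qed
  with G show thesis by (rule that)
qed

lemma eventually_nhds_entourage:
  fixes x :: "'a::uniform_space"
  assumes "eventually E uniformity"
  shows "eventually (\<lambda>y. E (x, y)) (nhds x)" "eventually (\<lambda>y. E (y, x)) (nhds x)"
proof -
  have *: "eventually (\<lambda>y. D (x, y)) (nhds x)" if "eventually D uniformity" for D
    unfolding eventually_nhds_uniformity by (rule eventually_mono[OF that]) auto
  show "eventually (\<lambda>y. E (x, y)) (nhds x)" "eventually (\<lambda>y. E (y, x)) (nhds x)"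
    using *[OF assms] *[OF uniformity_sym[OF assms]] by simp_all
qed

text \<open>
  An ultrafilter on a totally bounded set contains, for each entourage, one of the finitely many
  small sets of a cover. It is therefore a Cauchy filter, and it converges by completeness. The
  given filter then clusters at the limit of any finer ultrafilter.
\<close>

lemma complete_totally_bounded_imp_compact:
  fixes K :: "'a::uniform_space set"
  assumes "complete K" and tb: "totally_bounded K"
  shows "compact K"
  unfolding compact_filter
proof (intro allI impI)
  fix F :: "'a filter"
  assume F: "F \<noteq> bot" "eventually (\<lambda>x. x \<in> K) F"
  obtain G where G: "G \<le> F" "G \<noteq> bot"
    and ultra: "\<And>Q. eventually Q G \<or> eventually (\<lambda>x. \<not> Q x) G"
    using ultrafilter_below[OF F(1)] by blast
  have GK: "eventually (\<lambda>x. x \<in> K) G"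
    using F(2) G(1) by (rule filter_leD[rotated])
  have "cauchy_filter G"
    unfolding cauchy_filter_def
  proof (rule filter_leI)
    fix E :: "'a \<times> 'a \<Rightarrow> bool"
    assume E: "eventually E uniformity"
    obtain D where D: "eventually D uniformity"
      and DE: "\<And>x y z. D (x, y) \<Longrightarrow> D (y, z) \<Longrightarrow> E (x, z)"
      using uniformity_transE[OF E] by blast
    let ?D = "\<lambda>(x, y). D (x, y) \<and> D (y, x)"
    have "eventually ?D uniformity"
      using eventually_conj[OF D uniformity_sym[OF D]]
      by (simp add: case_prod_unfold)
    then obtain X where X: "finite X" "\<And>s. s \<in> K \<Longrightarrow> \<exists>x\<in>X. ?D (x, s)"
      using tb unfolding totally_bounded_def by meson
    have "\<exists>x\<in>X. eventually (\<lambda>s. ?D (x, s)) G"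
    proof (rule ccontr)
      assume "\<not> ?thesis"
      then have "\<forall>x\<in>X. eventually (\<lambda>s. \<not> ?D (x, s)) G"
        using ultra by blast
      then have "eventually (\<lambda>s. \<forall>x\<in>X. \<not> ?D (x, s)) G"
        by (rule eventually_ball_finite[OF X(1)])
      then have "eventually (\<lambda>s. False) G"
        using GK by eventually_elim (use X(2) in blast)
      with G(2) show False
        by (simp add: trivial_limit_def)
    qed
    then obtain x where x: "eventually (\<lambda>s. ?D (x, s)) G" by blast
    have "E (s, t)" if "?D (x, s)" "?D (x, t)" for s t
      using that DE by auto
    then show "eventually E (G \<times>\<^sub>F G)"
      unfolding eventually_prod_same using x by blast
  qed
  moreover have "G \<le> principal K"
    using GK by (simp add: le_principal)
  ultimately obtain x where x: "x \<in> K" "G \<le> nhds x"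
    using \<open>complete K\<close> G(2) unfolding complete_uniform by blast
  have "inf (nhds x) F \<noteq> bot"
    using x(2) G by (metis bot.extremum_uniqueI le_inf_iff)
  with x(1) show "\<exists>x\<in>K. inf (nhds x) F \<noteq> bot" by blast
qed

lemma compact_imp_totally_bounded:
  fixes K :: "'a::uniform_space set"
  assumes "compact K"
  shows "totally_bounded K"
  unfolding totally_bounded_def
proof (intro allI impI)
  fix E :: "'a \<times> 'a \<Rightarrow> bool"
  assume E: "eventually E uniformity"
  have "\<exists>U. open U \<and> x \<in> U \<and> (\<forall>y\<in>U. E (x, y))" for x
    using eventually_nhds_entourage(1)[OF E, of x] by (simp add: eventually_nhds)
  then obtain U where U: "\<And>x. open (U x)" "\<And>x. x \<in> U x" "\<And>x y. y \<in> U x \<Longrightarrow> E (x, y)"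
    by metis
  obtain X where "X \<subseteq> K" "finite X" "K \<subseteq> (\<Union>x\<in>X. U x)"
    by (rule compactE_image[OF assms, of K U]) (use U in auto)
  then show "\<exists>X. finite X \<and> (\<forall>s\<in>K. \<exists>x\<in>X. E (x, s))"
    using U(3) by (intro exI[of _ X]) blast
qed

text \<open>
  Every point of the closure is close to a point of \<open>S\<close>, so a net for \<open>S\<close> also serves the closure,
  at the price of composing the entourage with itself.
\<close>

lemma totally_bounded_closure:
  fixes S :: "'a::uniform_space set"
  assumes "totally_bounded S"
  shows "totally_bounded (closure S)"
  unfolding totally_bounded_def
proof (intro allI impI)
  fix E :: "'a \<times> 'a \<Rightarrow> bool"
  assume E: "eventually E uniformity"
  obtain D where D: "eventually D uniformity"
    and DE: "\<And>x y z. D (x, y) \<Longrightarrow> D (y, z) \<Longrightarrow> E (x, z)"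
    using uniformity_transE[OF E] by blast
  obtain X where X: "finite X" "\<And>s. s \<in> S \<Longrightarrow> \<exists>x\<in>X. D (x, s)"
    using assms D unfolding totally_bounded_def by meson
  have "\<exists>x\<in>X. E (x, y)" if y: "y \<in> closure S" for y
  proof -
    obtain U where "open U" "y \<in> U" and U: "\<And>s. s \<in> U \<Longrightarrow> D (s, y)"
      using eventually_nhds_entourage(2)[OF D, of y] by (auto simp: eventually_nhds)
    then obtain s where "s \<in> S" "s \<in> U"
      using y open_Int_closure_eq_empty[of U S] by blast
    then show ?thesis
      using X(2) U DE by blast
  qed
  with X(1) show "\<exists>X. finite X \<and> (\<forall>s\<in>closure S. \<exists>x\<in>X. E (x, s))" by blast
qed

section \<open>Relatively compact sets\<close>

lemma relatively_compact_subset_compact: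
  fixes S :: "'a::t2_space set"
  assumes "compact K" "S \<subseteq> K"
  shows "relatively_compact S"
  using assms unfolding relatively_compact_def
  by (metis closure_minimal compact_Int_closed closed_closure compact_imp_closed inf.absorb2)

lemma relatively_compact_continuous_image:
  fixes f :: "'a::topological_space \<Rightarrow> 'b::t2_space"
  assumes "relatively_compact S" "continuous_on UNIV f"
  shows "relatively_compact (f ` S)"
proof (rule relatively_compact_subset_compact)
  show "compact (f ` closure S)"
    using assms unfolding relatively_compact_def
    by (meson compact_continuous_image continuous_on_subset top_greatest)
qed (simp add: closure_subset image_mono)

lemma relatively_compact_image_add:
  fixes f g :: "'a \<Rightarrow> 'b::{topological_monoid_add, t2_space}"
  assumes "relatively_compact (f ` C)" "relatively_compact (g ` C)"
  shows "relatively_compact ((\<lambda>x. f x + g x) ` C)"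
proof (rule relatively_compact_subset_compact)
  let ?K = "closure (f ` C) \<times> closure (g ` C)"
  have "continuous_on ?K (\<lambda>z. fst z + snd z)"
    by (intro continuous_intros)
  then show "compact ((\<lambda>z. fst z + snd z) ` ?K)"
    using assms unfolding relatively_compact_def
    by (intro compact_continuous_image compact_Times)
  show "(\<lambda>x. f x + g x) ` C \<subseteq> (\<lambda>z. fst z + snd z) ` ?K"
  proof (rule image_subsetI)
    fix x assume "x \<in> C"
    then have "(f x, g x) \<in> ?K"
      by (auto intro: subsetD[OF closure_subset])
    then show "f x + g x \<in> (\<lambda>z. fst z + snd z) ` ?K"
      by (rule rev_image_eqI) simp
  qed
qed

section \<open>Seminorms and the canonical uniformity\<close>

context locally_convex_space
begin

lemma seminorm_add: "i \<in> I \<Longrightarrow> p i (x + y) \<le> p i x + p i y"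
  and seminorm_scale: "i \<in> I \<Longrightarrow> p i (scl c x) = norm c * p i x"
  using seminorms unfolding seminorm_def by auto

lemma seminorm_zero: "i \<in> I \<Longrightarrow> p i 0 = 0"
  using seminorm_scale[of i 0 0] by simp

lemma seminorm_minus: "i \<in> I \<Longrightarrow> p i (- x) = p i x"
  using seminorm_scale[of i "-1" x] by simp

lemma seminorm_diff: "i \<in> I \<Longrightarrow> p i (x - y) \<le> p i x + p i y"
  using seminorm_add[of i x "- y"] by (simp add: seminorm_minus)

lemma seminorm_minus_commute: "i \<in> I \<Longrightarrow> p i (x - y) = p i (y - x)"
  using seminorm_minus[of i "x - y"] by simp

lemma seminorm_diff_trans: "i \<in> I \<Longrightarrow> p i (x - z) \<le> p i (x - y) + p i (y - z)"
  using seminorm_add[of i "x - y" "y - z"] by simp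

lemma open_seminorm_ball:
  assumes "i \<in> I" "r > 0"
  shows "open {y. p i (y - x) < r}"
proof -
  have "openin (seminorm_topology UNIV I p) {y. p i (y - x) < r}"
    unfolding seminorm_topology_def using assms
    by (intro topology_generated_by_Basis) auto
  then show ?thesis
    by (simp add: generated[symmetric])
qed

text \<open>
  The generating balls need not be centred at \<open>x\<close>; the triangle inequality provides a ball centred
  at \<open>x\<close> inside each of them. The sets with this property contain the subbasis and are stable under
  finite intersections and arbitrary unions.
\<close>

lemma open_contains_seminorm_ball:
  assumes "open U" "x \<in> U"
  obtains J e where "finite J" "J \<subseteq> I" "e > 0" "\<And>y. (\<forall>i\<in>J. p i (y - x) < e) \<Longrightarrow> y \<in> U"
proof -
  have "generate_topology_on
      (insert UNIV {{y \<in> UNIV. p i (y - x) < r} |i x r. i \<in> I \<and> x \<in> UNIV \<and> r > 0}) U"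
    using assms(1) openin_topology_generated_by
    unfolding open_openin generated seminorm_topology_def by blast
  then have "\<exists>J e. finite J \<and> J \<subseteq> I \<and> e > 0 \<and> (\<forall>y. (\<forall>i\<in>J. p i (y - x) < e) \<longrightarrow> y \<in> U)"
    using assms(2)
  proof (induction arbitrary: x)
    case (Int a b)
    from Int.IH(1)[of x] Int.prems obtain J e where 1: "finite J" "J \<subseteq> I" "(e::real) > 0"
      "\<And>y. (\<forall>i\<in>J. p i (y - x) < e) \<Longrightarrow> y \<in> a" by auto
    from Int.IH(2)[of x] Int.prems obtain K d where 2: "finite K" "K \<subseteq> I" "(d::real) > 0"
      "\<And>y. (\<forall>i\<in>K. p i (y - x) < d) \<Longrightarrow> y \<in> b" by auto
    show ?case
      using 1 2 by (intro exI[of _ "J \<union> K"] exI[of _ "min e d"]) auto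
  next
    case (UN K)
    then obtain k where k: "k \<in> K" "x \<in> k" by auto
    from UN.IH[OF k] k(1) show ?case by blast
  next
    case (Basis s)
    show ?case
    proof (cases "s = UNIV")
      case True
      then show ?thesis by (intro exI[of _ "{}"] exI[of _ 1]) auto
    next
      case False
      then obtain i z r where s: "s = {y. p i (y - z) < r}" "i \<in> I"
        using Basis by auto
      have "p i (y - z) < r" if "p i (y - x) < r - p i (x - z)" for y
        using that seminorm_diff_trans[OF s(2), of y z x] by linarith
      then show ?thesis
        using Basis.prems s by (intro exI[of _ "{i}"] exI[of _ "r - p i (x - z)"]) auto
    qed
  qed auto
  then show thesis using that by blast
qed

lemma eventually_nhds_zero_seminorms:
  "eventually Q (nhds 0) \<longleftrightarrow>
    (\<exists>J e. finite J \<and> J \<subseteq> I \<and> e > 0 \<and> (\<forall>x. (\<forall>i\<in>J. p i x < e) \<longrightarrow> Q x))" (is "_ \<longleftrightarrow> ?R")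
proof
  assume "eventually Q (nhds 0)"
  then obtain U where U: "open U" "0 \<in> U" "\<And>x. x \<in> U \<Longrightarrow> Q x"
    unfolding eventually_nhds by blast
  obtain J e where "finite J" "J \<subseteq> I" "e > 0" "\<And>y. (\<forall>i\<in>J. p i (y - 0) < e) \<Longrightarrow> y \<in> U"
    using open_contains_seminorm_ball[OF U(1,2)] by blast
  with U(3) show ?R
    by (intro exI[of _ J] exI[of _ e]) auto
next
  assume ?R
  then obtain J e where J: "finite J" "J \<subseteq> I" "e > 0" "\<And>x. (\<forall>i\<in>J. p i x < e) \<Longrightarrow> Q x"
    by blast
  have "eventually (\<lambda>x. p i x < e) (nhds 0)" if "i \<in> J" for i
    using open_seminorm_ball[of i e 0] that J seminorm_zero[of i]
    unfolding eventually_nhds by (intro exI[of _ "{y. p i (y - 0) < e}"]) auto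
  then have "eventually (\<lambda>x. \<forall>i\<in>J. p i x < e) (nhds 0)"
    using J(1) by (intro eventually_ball_finite) auto
  then show "eventually Q (nhds 0)"
    by (rule eventually_mono) (rule J(4))
qed

text \<open>
  In a commutative group with uniformly continuous operations, the uniformity consists of the
  relations that contain \<open>y - x \<in> U\<close> for a neighbourhood \<open>U\<close> of zero; the seminorms describe these.
\<close>

lemma eventually_uniformity_seminorms:
  "eventually E uniformity \<longleftrightarrow>
    (\<exists>J e. finite J \<and> J \<subseteq> I \<and> e > 0 \<and> (\<forall>x y. (\<forall>i\<in>J. p i (y - x) < e) \<longrightarrow> E (x, y)))"
    (is "?L \<longleftrightarrow> ?R")
proof -
  have "?L \<longleftrightarrow> (\<exists>Q. eventually Q (nhds 0) \<and> (\<forall>x y. Q (y - x) \<longrightarrow> E (x, y)))"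
    unfolding cauchy_seq_finset_iff_vanishing eventually_filtercomap by auto
  also have "\<dots> \<longleftrightarrow> ?R"
  proof
    assume "\<exists>Q. eventually Q (nhds 0) \<and> (\<forall>x y. Q (y - x) \<longrightarrow> E (x, y))"
    then obtain Q where Q: "eventually Q (nhds 0)" "\<And>x y. Q (y - x) \<Longrightarrow> E (x, y)"
      by blast
    from Q(1) obtain J e where "finite J" "J \<subseteq> I" "e > 0" "\<And>x. (\<forall>i\<in>J. p i x < e) \<Longrightarrow> Q x"
      unfolding eventually_nhds_zero_seminorms by blast
    with Q(2) show ?R
      by (intro exI[of _ J] exI[of _ e]) simp
  next
    assume ?R
    then obtain J e where J: "finite J" "J \<subseteq> I" "e > 0"
      and E: "\<And>x y. (\<forall>i\<in>J. p i (y - x) < e) \<Longrightarrow> E (x, y)"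
      by blast
    have "eventually (\<lambda>x. \<forall>i\<in>J. p i x < e) (nhds 0)"
      unfolding eventually_nhds_zero_seminorms using J by blast
    with E show "\<exists>Q. eventually Q (nhds 0) \<and> (\<forall>x y. Q (y - x) \<longrightarrow> E (x, y))"
      by (intro exI[of _ "\<lambda>x. \<forall>i\<in>J. p i x < e"]) simp
  qed
  finally show ?thesis .
qed

lemma totally_bounded_seminorms:
  "totally_bounded S \<longleftrightarrow>
    (\<forall>J e. finite J \<longrightarrow> J \<subseteq> I \<longrightarrow> e > 0 \<longrightarrow>
      (\<exists>X. finite X \<and> (\<forall>s\<in>S. \<exists>x\<in>X. \<forall>i\<in>J. p i (s - x) < e)))" (is "?L \<longleftrightarrow> ?R")
proof
  assume L: ?L
  show ?R
  proof (intro allI impI)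
    fix J e assume "finite J" "J \<subseteq> I" "(e::real) > 0"
    then have "eventually (\<lambda>(x, y). \<forall>i\<in>J. p i (y - x) < e) uniformity"
      unfolding eventually_uniformity_seminorms by auto
    with L show "\<exists>X. finite X \<and> (\<forall>s\<in>S. \<exists>x\<in>X. \<forall>i\<in>J. p i (s - x) < e)"
      unfolding totally_bounded_def by fastforce
  qed
next
  assume R: ?R
  show ?L
    unfolding totally_bounded_def
  proof (intro allI impI)
    fix E :: "'v \<times> 'v \<Rightarrow> bool"
    assume "eventually E uniformity"
    then obtain J e where J: "finite J" "J \<subseteq> I" "e > 0"
      and E: "\<And>x y. (\<forall>i\<in>J. p i (y - x) < e) \<Longrightarrow> E (x, y)"
      unfolding eventually_uniformity_seminorms by blast
    obtain X where X: "finite X" "\<forall>s\<in>S. \<exists>x\<in>X. \<forall>i\<in>J. p i (s - x) < e"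
      using R[rule_format, OF J] by (elim exE conjE)
    have "\<exists>x\<in>X. E (x, s)" if s: "s \<in> S" for s
    proof -
      obtain x where "x \<in> X" "\<forall>i\<in>J. p i (s - x) < e"
        using X(2)[rule_format, OF s] by (elim bexE)
      then show ?thesis
        by (intro bexI[of _ x] E)
    qed
    with X(1) show "\<exists>X. finite X \<and> (\<forall>s\<in>S. \<exists>x\<in>X. E (x, s))"
      by (intro exI[of _ X]) simp
  qed
qed

text \<open>
  If \<open>p i \<le> M i\<close> on \<open>B\<close> for the finitely many \<open>i\<close> that define a given neighbourhood of zero, then
  \<open>B\<close> is absorbed as soon as the scalar exceeds every \<open>M i / e\<close>; the sum of the \<open>\<bar>M i\<bar>\<close> serves as
  a bound for all of them.
\<close>

lemma tvs_bounded_seminorms: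
  assumes "\<And>i. i \<in> I \<Longrightarrow> \<exists>M. \<forall>x\<in>B. p i x \<le> M"
  shows "tvs_bounded scl B"
  unfolding tvs_bounded_def
proof (intro allI impI)
  fix U :: "'v set" assume "open U" "0 \<in> U"
  then obtain J e where J: "finite J" "J \<subseteq> I" "e > 0" "\<And>y. (\<forall>i\<in>J. p i (y - 0) < e) \<Longrightarrow> y \<in> U"
    using open_contains_seminorm_ball by blast
  obtain M where M: "\<And>i x. i \<in> I \<Longrightarrow> x \<in> B \<Longrightarrow> p i x \<le> M i"
    using assms by metis
  define s where "s = ((\<Sum>i\<in>J. \<bar>M i\<bar>) + 1) / e"
  have s: "s > 0"
    using J(3) unfolding s_def by (intro divide_pos_pos add_nonneg_pos sum_nonneg) auto
  have "x \<in> scl c ` U" if c: "norm c \<ge> s" and x: "x \<in> B" for c x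
  proof -
    have "c \<noteq> 0" using c s by auto
    have "p i (scl (inverse c) x) < e" if i: "i \<in> J" for i
    proof -
      have "p i x \<le> \<bar>M i\<bar>"
        using M[of i x] i J(2) x by force
      also have "\<dots> \<le> (\<Sum>i\<in>J. \<bar>M i\<bar>)"
        using J(1) i by (intro member_le_sum) auto
      also have "\<dots> < e * s"
        using J(3) by (simp add: s_def)
      also have "\<dots> \<le> e * norm c"
        using c J(3) by simp
      finally have "p i x < e * norm c" .
      moreover have "p i (scl (inverse c) x) = p i x / norm c"
        using i J(2) \<open>c \<noteq> 0\<close>
        by (simp add: seminorm_scale subset_iff nonzero_norm_inverse divide_inverse mult.commute)
      ultimately show ?thesis
        using \<open>c \<noteq> 0\<close> by (simp add: pos_divide_less_eq)
    qed
    then have "scl (inverse c) x \<in> U"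
      using J(4) by simp
    moreover have "x = scl c (scl (inverse c) x)"
      using \<open>c \<noteq> 0\<close> by simp
    ultimately show ?thesis by blast
  qed
  with s show "\<exists>s>0. \<forall>c. s \<le> norm c \<longrightarrow> B \<subseteq> scl c ` U" by blast
qed

lemma tvs_bounded_closure_seminorms:
  assumes "\<And>i. i \<in> I \<Longrightarrow> \<exists>M. \<forall>x\<in>B. p i x \<le> M"
  shows "tvs_bounded scl (closure B)"
proof (rule tvs_bounded_seminorms)
  fix i assume i: "i \<in> I"
  with assms obtain M where M: "\<And>x. x \<in> B \<Longrightarrow> p i x \<le> M" by blast
  have "p i y \<le> M + 1" if "y \<in> closure B" for y
  proof -
    have "y \<in> {x. p i (x - y) < 1} \<inter> closure B"
      using i that by (simp add: seminorm_zero)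
    then have "{x. p i (x - y) < 1} \<inter> B \<noteq> {}"
      using open_Int_closure_eq_empty[OF open_seminorm_ball[OF i zero_less_one], of y B] by blast
    then obtain x where x: "x \<in> B" "p i (x - y) < 1"
      by blast
    have "p i y \<le> p i x + p i (x - y)"
      using seminorm_diff[OF i, of x "x - y"] by simp
    with x M[of x] show ?thesis by linarith
  qed
  then show "\<exists>M. \<forall>x\<in>closure B. p i x \<le> M" by blast
qed

text \<open>
  Quasi-completeness speaks of closed bounded sets, so it is applied to the closure, to which both
  boundedness and total boundedness pass.
\<close>

lemma relatively_compact_if_totally_bounded:
  assumes "quasi_complete scl" "totally_bounded S"
    and "\<And>i. i \<in> I \<Longrightarrow> \<exists>M. \<forall>x\<in>S. p i x \<le> M"
  shows "relatively_compact S"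
proof -
  have "complete (closure S)"
    using assms(1) tvs_bounded_closure_seminorms[OF assms(3)]
    unfolding quasi_complete_def by blast
  then show ?thesis
    unfolding relatively_compact_def
    by (rule complete_totally_bounded_imp_compact[OF _ totally_bounded_closure[OF assms(2)]])
qed

end

section \<open>Operator seminorms\<close>

locale normed_to_locally_convex =
  E: normed_vector_space scaleE + F: locally_convex_space scaleF I p
  for scaleE :: "'k::real_normed_field \<Rightarrow> 'e::real_normed_vector \<Rightarrow> 'e"
    and scaleF :: "'k \<Rightarrow> 'f::{uniform_topological_group_add, ab_group_add} \<Rightarrow> 'f"
    and I :: "'i set" and p :: "'i \<Rightarrow> 'f \<Rightarrow> real"
begin

sublocale pair: vector_space_pair scaleE scaleF
  by unfold_locales

lemma operator_scale:
  "T \<in> continuous_linear_operators scaleE scaleF \<Longrightarrow> T (scaleE c x) = scaleF c (T x)"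
  unfolding continuous_linear_operators_def by (simp add: pair.linear_scale)

lemma operator_zero: "T \<in> continuous_linear_operators scaleE scaleF \<Longrightarrow> T 0 = 0"
  unfolding continuous_linear_operators_def by (simp add: pair.linear_0)

text \<open>
  Continuity at zero gives a ball of radius \<open>d\<close> on which \<open>p i \<circ> T\<close> is below \<open>1\<close>; shrinking by
  \<open>d/2\<close> maps the closed unit ball into it.
\<close>

lemma operator_bounded_on_unit_ball:
  assumes T: "T \<in> continuous_linear_operators scaleE scaleF" and i: "i \<in> I"
  obtains M where "\<And>x. norm x \<le> 1 \<Longrightarrow> p i (T x) \<le> M"
proof -
  have "open (T -` {y. p i (y - 0) < 1})"
    using T i unfolding continuous_linear_operators_def
    by (intro open_vimage F.open_seminorm_ball) auto
  moreover have "0 \<in> T -` {y. p i (y - 0) < 1}"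
    using operator_zero[OF T] F.seminorm_zero[OF i] by simp
  ultimately obtain d where d: "d > 0" "ball 0 d \<subseteq> T -` {y. p i (y - 0) < 1}"
    unfolding open_contains_ball by blast
  have "p i (T x) \<le> 2 / d" if x: "norm x \<le> 1" for x
  proof -
    let ?c = "of_real (d / 2) :: 'k"
    have c: "norm ?c = d / 2"
      unfolding norm_of_real using d(1) by simp
    have "norm (scaleE ?c x) \<le> d / 2"
      unfolding E.norm_scale c using x d(1) by (simp add: mult_left_le)
    then have "scaleE ?c x \<in> ball 0 d"
      using d(1) by simp
    then have "p i (T (scaleE ?c x)) < 1"
      using d(2) by auto
    then have "d / 2 * p i (T x) < 1"
      unfolding operator_scale[OF T] F.seminorm_scale[OF i] c .
    then show ?thesis
      using d(1) by (simp add: field_simps)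
  qed
  then show thesis by (rule that)
qed

text \<open>
  A real supremum bounds the values only if these are bounded above, and here they are because both
  operators are bounded on the unit ball.
\<close>

lemma seminorm_diff_le_operator_seminorm:
  assumes S: "S \<in> continuous_linear_operators scaleE scaleF"
    and T: "T \<in> continuous_linear_operators scaleE scaleF"
    and i: "i \<in> I" and x: "norm x \<le> 1"
  shows "p i (S x - T x) \<le> operator_seminorm (p i) (S - T)"
proof -
  obtain M where M: "\<And>x. norm x \<le> 1 \<Longrightarrow> p i (S x) \<le> M"
    using operator_bounded_on_unit_ball[OF S i] by blast
  obtain N where N: "\<And>x. norm x \<le> 1 \<Longrightarrow> p i (T x) \<le> N"
    using operator_bounded_on_unit_ball[OF T i] by blast
  have "p i ((S - T) x) \<le> M + N" if "norm x \<le> 1" for x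
    using M[OF that] N[OF that] F.seminorm_diff[OF i, of "S x" "T x"] by simp
  then have "bdd_above ((\<lambda>x. p i ((S - T) x)) ` {x. norm x \<le> 1})"
    by (intro bdd_aboveI2) simp
  then have "p i ((S - T) x) \<le> operator_seminorm (p i) (S - T)"
    unfolding operator_seminorm_def using x by (intro cSUP_upper) auto
  then show ?thesis by simp
qed

lemma operator_seminorm_zero:
  assumes "i \<in> I"
  shows "operator_seminorm (p i) (0 :: 'e \<Rightarrow> 'f) = 0"
proof -
  have "(0::'e) \<in> {x. norm x \<le> 1}"
    by simp
  then have "(SUP x\<in>{x::'e. norm x \<le> 1}. 0::real) = 0"
    by (intro cSUP_const) blast
  then show ?thesis
    unfolding operator_seminorm_def by (simp add: F.seminorm_zero[OF assms])
qed

text \<open>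
  The operators whose difference from \<open>T\<close> is small in finitely many operator seminorms form a
  neighbourhood of \<open>T\<close>, so it meets \<open>A\<close>. The carrier is added to the intersection to cover the case
  that \<open>J\<close> is empty.
\<close>

lemma closure_of_approximation:
  assumes T: "T \<in> bounded_convergence_topology scaleE scaleF I p closure_of A"
    and A: "A \<subseteq> continuous_linear_operators scaleE scaleF"
    and J: "finite J" "J \<subseteq> I" and e: "e > 0"
  obtains S where "S \<in> A" "\<And>i x. i \<in> J \<Longrightarrow> norm x \<le> 1 \<Longrightarrow> p i (S x - T x) < e"
proof -
  let ?V = "continuous_linear_operators scaleE scaleF"
  let ?X = "bounded_convergence_topology scaleE scaleF I p"
  let ?B = "\<lambda>i. {S \<in> ?V. operator_seminorm (p i) (S - T) < e}"
  have top: "topspace ?X = ?V"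
    unfolding bounded_convergence_topology_def by simp
  have TV: "T \<in> ?V"
    using T top unfolding in_closure_of by simp
  have "openin ?X (?B i)" if "i \<in> J" for i
    unfolding bounded_convergence_topology_def seminorm_topology_def
    using that J(2) TV e by (intro topology_generated_by_Basis) auto
  moreover have "openin ?X ?V"
    using openin_topspace[of ?X] unfolding top .
  ultimately have "openin ?X (\<Inter> (insert ?V (?B ` J)))"
    using J(1) by (intro openin_Inter) auto
  moreover have "T \<in> \<Inter> (insert ?V (?B ` J))"
    using TV e J(2) by (auto simp: operator_seminorm_zero subset_iff)
  ultimately obtain S where S: "S \<in> A" "S \<in> \<Inter> (insert ?V (?B ` J))"
    using T unfolding in_closure_of by meson
  have "p i (S x - T x) < e" if "i \<in> J" "norm x \<le> 1" for i x
    using seminorm_diff_le_operator_seminorm[of S T i x] S A TV J(2) that by force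
  with S(1) show thesis by (rule that)
qed

text \<open>
  A finite \<open>e/2\<close>-net for \<open>S ` C\<close> is a finite \<open>e\<close>-net for \<open>T ` C\<close> as soon as \<open>S\<close> and \<open>T\<close> differ by
  less than \<open>e/2\<close> on \<open>C\<close>.
\<close>

lemma totally_bounded_image_of_limit:
  assumes T: "T \<in> bounded_convergence_topology scaleE scaleF I p closure_of A"
    and A: "A \<subseteq> continuous_linear_operators scaleE scaleF"
    and tb: "\<And>S. S \<in> A \<Longrightarrow> totally_bounded (S ` C)"
    and C: "\<And>x. x \<in> C \<Longrightarrow> norm x \<le> 1"
  shows "totally_bounded (T ` C)"
  unfolding F.totally_bounded_seminorms
proof (intro allI impI)
  fix J e assume J: "finite J" "J \<subseteq> I" and e: "(e::real) > 0"
  obtain S where S: "S \<in> A" "\<And>i x. i \<in> J \<Longrightarrow> norm x \<le> 1 \<Longrightarrow> p i (S x - T x) < e / 2"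
    using closure_of_approximation[OF T A J, of "e / 2"] e by auto
  obtain X where X: "finite X" "\<And>x. x \<in> C \<Longrightarrow> \<exists>z\<in>X. \<forall>i\<in>J. p i (S x - z) < e / 2"
    using tb[OF S(1)] J e unfolding F.totally_bounded_seminorms
    by (metis half_gt_zero image_eqI)
  have "\<exists>z\<in>X. \<forall>i\<in>J. p i (T x - z) < e" if x: "x \<in> C" for x
  proof -
    from X(2)[OF x] obtain z where z: "z \<in> X" "\<And>i. i \<in> J \<Longrightarrow> p i (S x - z) < e / 2" by blast
    have "p i (T x - z) < e" if i: "i \<in> J" for i
    proof -
      have iI: "i \<in> I" using i J(2) by blast
      have "p i (T x - z) \<le> p i (S x - T x) + p i (S x - z)"
        using F.seminorm_diff_trans[OF iI, of "T x" z "S x"]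
          F.seminorm_minus_commute[OF iI, of "T x" "S x"] by simp
      with S(2)[OF i C[OF x]] z(2)[OF i] show ?thesis by linarith
    qed
    with z(1) show ?thesis by blast
  qed
  with X(1) show "\<exists>X. finite X \<and> (\<forall>s\<in>T ` C. \<exists>x\<in>X. \<forall>i\<in>J. p i (s - x) < e)" by blast
qed

end

section \<open>Closedness of the operators that are compact on a class of sets\<close>

lemma (in topological_vector_space) continuous_on_scale_right: "continuous_on UNIV (scl c)"
proof -
  have "continuous_on UNIV (\<lambda>x. (\<lambda>(c, x). scl c x) (c, x))"
    by (rule continuous_on_compose2[OF continuous_scale]) (auto intro!: continuous_intros)
  then show ?thesis by simp
qed

text \<open>
  Being in the closure controls \<open>T\<close> on the unit ball only. A set \<open>C\<close> of norm at most \<open>r\<close> is replaced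
  by \<open>c C\<close> with \<open>c = 1/r\<close>, which has the property because it is a cone property; the homeomorphism
  \<open>y \<mapsto> y / c\<close> then transports relative compactness from \<open>T ` (c C)\<close> back to \<open>T ` C\<close>.
\<close>

lemma closedin_operators_compact_on:
  fixes scaleE :: "'k::real_normed_field \<Rightarrow> 'e::real_normed_vector \<Rightarrow> 'e"
    and scaleF :: "'k \<Rightarrow> 'f::{uniform_topological_group_add, ab_group_add, t2_space} \<Rightarrow> 'f"
  assumes "normed_vector_space scaleE" "locally_convex_space scaleF I p"
    and qc: "quasi_complete scaleF" and cone: "cone_property scaleE P"
  shows "closedin (bounded_convergence_topology scaleE scaleF I p)
    (operators_compact_on scaleE scaleF P)"
proof -
  interpret normed_to_locally_convex scaleE scaleF I p
    using assms(1,2) by (simp add: normed_to_locally_convex_def)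
  let ?V = "continuous_linear_operators scaleE scaleF"
  let ?X = "bounded_convergence_topology scaleE scaleF I p"
  let ?A = "operators_compact_on scaleE scaleF P"
  have AV: "?A \<subseteq> ?V"
    unfolding operators_compact_on_def by blast
  have top: "topspace ?X = ?V"
    unfolding bounded_convergence_topology_def by simp
  have "T \<in> ?A" if T: "T \<in> ?X closure_of ?A" for T
  proof -
    have TV: "T \<in> ?V"
      using T top unfolding in_closure_of by simp
    have "relatively_compact (T ` C)" if C: "bounded C" "P C" for C
    proof -
      obtain r where r: "r > 0" "\<And>x. x \<in> C \<Longrightarrow> norm x \<le> r"
        using C(1) unfolding bounded_pos by blast
      define c :: 'k where "c = of_real (1 / r)"
      have c: "norm c = 1 / r" "c \<noteq> 0"
        unfolding c_def norm_of_real using r(1) by auto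
      let ?D = "scaleE c ` C"
      have D: "norm x \<le> 1" if "x \<in> ?D" for x
        using that r by (auto simp: E.norm_scale c)
      have "P ?D"
        using cone C divide_pos_pos[OF zero_less_one r(1)]
        unfolding cone_property_def c_def by blast
      moreover have "bounded ?D"
        using D unfolding bounded_iff by blast
      ultimately have "relatively_compact (S ` ?D)" if "S \<in> ?A" for S
        using that unfolding operators_compact_on_def by blast
      then have "totally_bounded (S ` ?D)" if "S \<in> ?A" for S
        using that unfolding relatively_compact_def
        by (meson closure_subset compact_imp_totally_bounded totally_bounded_subset)
      then have "totally_bounded (T ` ?D)"
        by (rule totally_bounded_image_of_limit[OF T AV _ D])
      moreover have "\<exists>M. \<forall>y\<in>T ` ?D. p i y \<le> M" if i: "i \<in> I" for i
      proof -
        obtain M where M: "\<And>x. norm x \<le> 1 \<Longrightarrow> p i (T x) \<le> M"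
          using operator_bounded_on_unit_ball[OF TV i] by blast
        have "\<forall>y\<in>T ` ?D. p i y \<le> M"
          by (intro ballI) (metis M D imageE)
        then show ?thesis ..
      qed
      ultimately have "relatively_compact (T ` ?D)"
        by (rule F.relatively_compact_if_totally_bounded[OF qc])
      then have "relatively_compact (scaleF (inverse c) ` (T ` ?D))"
        by (rule relatively_compact_continuous_image[OF _ F.continuous_on_scale_right])
      also have "scaleF (inverse c) ` (T ` ?D) = T ` C"
        using c(2) by (simp add: image_image operator_scale[OF TV])
      finally show ?thesis .
    qed
    with TV show ?thesis
      unfolding operators_compact_on_def by blast
  qed
  then show ?thesis
    using AV closure_of_subset[of ?A ?X] unfolding closure_of_eq[symmetric] top by blast
qed

section \<open>Linear structure\<close>

lemma module_pointwise_scale: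
  assumes "vector_space scl"
  shows "module (pointwise_scale scl :: _ \<Rightarrow> ('e \<Rightarrow> _) \<Rightarrow> _)"
proof -
  interpret vector_space scl by fact
  show ?thesis
    by unfold_locales
      (auto simp: pointwise_scale_def fun_eq_iff scale_right_distrib scale_left_distrib)
qed

lemma subspace_operators_compact_on:
  fixes scaleE :: "'k::real_normed_field \<Rightarrow> 'e::real_normed_vector \<Rightarrow> 'e"
    and scaleF :: "'k \<Rightarrow> 'f::{uniform_topological_group_add, ab_group_add, t2_space} \<Rightarrow> 'f"
  assumes "vector_space scaleE" "topological_vector_space scaleF"
  shows "module.subspace (pointwise_scale scaleF) (operators_compact_on scaleE scaleF P)"
proof -
  interpret F: topological_vector_space scaleF by fact
  interpret pair: vector_space_pair scaleE scaleF
    using assms(1) F.vector_space_axioms by (simp add: vector_space_pair_def)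
  let ?A = "operators_compact_on scaleE scaleF P"
  note defs = operators_compact_on_def continuous_linear_operators_def
  show ?thesis
    unfolding module.subspace_def[OF module_pointwise_scale[OF F.vector_space_axioms]]
  proof (intro conjI ballI allI)
    have "relatively_compact ((\<lambda>x. 0) ` C :: 'f set)" for C :: "'e set"
      by (rule relatively_compact_subset_compact[of "{0}"]) auto
    then show "0 \<in> ?A"
      by (simp add: defs zero_fun_def pair.linear_zero)
  next
    fix S T assume "S \<in> ?A" "T \<in> ?A"
    then show "S + T \<in> ?A"
      by (auto simp: defs plus_fun_def
          intro: pair.linear_compose_add continuous_on_add relatively_compact_image_add)
  next
    fix c T assume T: "T \<in> ?A"
    have "continuous_on UNIV (\<lambda>x. scaleF c (T x))"
      using T continuous_on_compose2[OF F.continuous_on_scale_right] by (auto simp: defs)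
    moreover have "relatively_compact ((\<lambda>x. scaleF c (T x)) ` C)" if "bounded C" "P C" for C
      using T that relatively_compact_continuous_image[OF _ F.continuous_on_scale_right]
      by (auto simp: defs image_image[symmetric, of "scaleF c" T])
    ultimately show "pointwise_scale scaleF c T \<in> ?A"
      using T by (auto simp: defs pointwise_scale_def intro: pair.linear_compose_scale_right)
  qed
qed

theorem theorem2p2:
  fixes scaleE :: "'k::real_normed_field \<Rightarrow> 'e::real_normed_vector \<Rightarrow> 'e"
    and scaleF :: "'k \<Rightarrow> 'f::{uniform_topological_group_add, ab_group_add, t2_space} \<Rightarrow> 'f"
    and I :: "'i set" and p :: "'i \<Rightarrow> 'f \<Rightarrow> real"
    and P :: "'e set \<Rightarrow> bool"
  assumes "normed_vector_space scaleE"
    and "locally_convex_space scaleF I p"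
    and "quasi_complete scaleF"
    and "cone_property scaleE P"
  shows "module.subspace (pointwise_scale scaleF) (operators_compact_on scaleE scaleF P) \<and>
    closedin (bounded_convergence_topology scaleE scaleF I p) (operators_compact_on scaleE scaleF P)"
  using assms subspace_operators_compact_on[of scaleE scaleF P]
    closedin_operators_compact_on[of scaleE scaleF I p P]
  by (simp add: normed_vector_space_def locally_convex_space_def)

end
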